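(* Let $f(x,y)\in\mathbb{R}[x,y]$ be an admissible polynomial which is not a square in $\mathbb{R}[x,y]$. Then $p(\mathbb{R}[x,y,\sqrt{f(x,y)}])=\infty$.
   Context: Pythagoras number: for a commutative ring $R$ with identity, $p(R)$ is the smallest positive integer $g$ such that every element of $R$ which is a sum of squares in $R$ can be written as a sum of at most $g$ squares in $R$; if no such $g$ exists, $p(R)=\infty$. Strictly admissible: let $f(x,y)\in\mathbb{R}[x,y]$ be a non-constant polynomial with $f(0,0)=0$. Let $d=\deg_y f(x,y)$ and, among the monomials of $f$ with nonzero coefficient whose degree in $y$ equals $d$, let $\alpha x^b y^d$ ($\alpha\neq 0$) be the one with the largest exponent $b$. Then $f$ is called strictly admissible if either (a) $\alpha>0$ and both $b$ and $d$ are even, or (b) $b$ or $d$ is odd. Admissible: $f(x,y)$ is called admissible if there exists an invertible matrix $M\in \mathrm{GL}_2(\mathbb{R})$ such that $f\circ M$ (the polynomial obtained from $f$ by the linear change of variables $M$) is strictly admissible. For $f$ not a square in $\mathbb{R}[x,y]$, the ring $\mathbb{R}[x,y,\sqrt{f(x,y)}]$ is (isomorphic to) $\mathbb{R}[x,y,z]/(z^2-f(x,y))$. *)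

theory Defs
  imports
    "HOL-Analysis.Analysis"
    "HOL-Algebra.QuotRing"
    "HOL-Decision_Procs.Algebra_Aux"
    "HOL-Library.Extended_Nat"
begin

section \<open>Pythagoras number of a ring\<close>

definition is_sum_of_squares :: "('a, 'b) ring_scheme \<Rightarrow> nat \<Rightarrow> 'a \<Rightarrow> bool" where
  "is_sum_of_squares R n a \<longleftrightarrow>
     (\<exists>s. s \<in> {..<n} \<rightarrow> carrier R \<and> a = (\<Oplus>\<^bsub>R\<^esub>i\<in>{..<n}. s i \<otimes>\<^bsub>R\<^esub> s i))"

definition pythagoras_bound :: "('a, 'b) ring_scheme \<Rightarrow> nat \<Rightarrow> bool" where
  "pythagoras_bound R g \<longleftrightarrow>
     (\<forall>a n. is_sum_of_squares R n a \<longrightarrow> (\<exists>m\<le>g. is_sum_of_squares R m a))"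

definition pythagoras_number :: "('a, 'b) ring_scheme \<Rightarrow> enat" where
  "pythagoras_number R =
     (if \<exists>g>0. pythagoras_bound R g then enat (LEAST g. g > 0 \<and> pythagoras_bound R g) else \<infinity>)"


section \<open>Bivariate polynomials and admissibility\<close>

text \<open>
  The ring $R[x,y]$ over the reals is rendered as \<^typ>\<open>real poly poly\<close>: the outer
  variable is $y$, and the coefficients, of type \<^typ>\<open>real poly\<close>, are polynomials in $x$.
  So \<^term>\<open>degree f\<close> is the degree in $y$, \<^term>\<open>[:[:0, 1:]:]\<close> is $x$, and
  \<^term>\<open>[:0, 1:]\<close> is $y$. The coefficient of $y^d$, for $d$ the degree in $y$, is
  \<^term>\<open>lead_coeff f\<close>, a polynomial in $x$; its leading monomial gives $b$ and $\alpha$.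
\<close>

definition strictly_admissible :: "real poly poly \<Rightarrow> bool" where
  "strictly_admissible f \<longleftrightarrow>
     (\<nexists>c. f = [:[:c:]:]) \<and> poly (poly f 0) 0 = 0 \<and>
     (let d = degree f;
          b = degree (lead_coeff f);
          \<alpha> = lead_coeff (lead_coeff f)
      in (\<alpha> > 0 \<and> even b \<and> even d) \<or> (odd b \<or> odd d))"

text \<open>The polynomial $f(u(x,y), v(x,y))$.\<close>

definition subst2 :: "real poly poly \<Rightarrow> real poly poly \<Rightarrow> real poly poly \<Rightarrow> real poly poly" where
  "subst2 f u v = poly (map_poly (\<lambda>p. poly (map_poly (\<lambda>c. [:[:c:]:]) p) u) f) v"

definition linear_change :: "real poly poly \<Rightarrow> real^2^2 \<Rightarrow> real poly poly" where
  "linear_change f M =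
     subst2 f ([:[:M $ 1 $ 1:]:] * [:[:0, 1:]:] + [:[:M $ 1 $ 2:]:] * [:0, 1:])
              ([:[:M $ 2 $ 1:]:] * [:[:0, 1:]:] + [:[:M $ 2 $ 2:]:] * [:0, 1:])"

definition admissible :: "real poly poly \<Rightarrow> bool" where
  "admissible f \<longleftrightarrow> (\<exists>M :: real^2^2. invertible M \<and> strictly_admissible (linear_change f M))"

lemma poly_subst2:
  "poly (poly (subst2 f u v) [:y:]) x =
     poly (poly f [:poly (poly v [:y:]) x:]) (poly (poly u [:y:]) x)"
proof -
  have inner: "poly (poly (poly (map_poly (\<lambda>c. [:[:c:]:]) p) u) [:y:]) x
      = poly p (poly (poly u [:y:]) x)" for p :: "real poly"
    by (induction p) (simp_all add: map_poly_pCons)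
  show ?thesis
    unfolding subst2_def by (induction f) (simp_all add: map_poly_pCons inner)
qed

lemma poly_linear_change:
  "poly (poly (linear_change f M) [:y:]) x =
     poly (poly f [:M $ 2 $ 1 * x + M $ 2 $ 2 * y:]) (M $ 1 $ 1 * x + M $ 1 $ 2 * y)"
  by (simp add: linear_change_def poly_subst2 algebra_simps)


section \<open>Adjoining a square root\<close>

text \<open>
  The ring $R[x,y,z]/(z^2 - f)$. The outermost variable of \<^typ>\<open>real poly poly poly\<close> is $z$, so
  $z^2 - f$ is \<^term>\<open>[:- f, 0, 1:]\<close>. The constant \<^const>\<open>cring_class_ops\<close> turns the
  type-class ring into a ring with explicit carrier.
\<close>

definition adjoin_sqrt :: "real poly poly \<Rightarrow> real poly poly poly set ring" where
  "adjoin_sqrt f =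
     (let P = (cring_class_ops :: real poly poly poly ring) in P Quot (PIdl\<^bsub>P\<^esub> [:- f, 0, 1:]))"

end

theory Submission
  imports Defs
begin

text \<open>
  An identity \<open>h = \<Sum>\<^sub>l (s\<^sub>l + t\<^sub>l\<surd>f)\<^sup>2\<close> in the ring gives
  \<open>h = \<Sum>\<^sub>l s\<^sub>l\<^sup>2 + f \<Sum>\<^sub>l t\<^sub>l\<^sup>2\<close> in \<open>R[x,y]\<close>, and it is enough to find, for every \<open>n\<close>, a sum
  \<open>h\<close> of \<open>n + 1\<close> squares in \<open>R[x,y]\<close> that admits no such identity with at most \<open>n\<close> terms.

  Admissibility says that, after a linear change of variables, the lexicographically leading
  monomial \<open>x\<^sup>b y\<^sup>d\<close> of \<open>f\<close> has a positive coefficient; when it comes out negative, \<open>b\<close> or \<open>d\<close> is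
  odd and a reflection repairs the sign (\<open>admissible_imp_positive\<close>). Two things follow.
  First, give \<open>x\<close> the weight 1 and \<open>y\<close> a weight \<open>W\<close> that exceeds all \<open>x\<close>-degrees in \<open>f\<close>. Then
  \<open>x\<^sup>b y\<^sup>d\<close> is the only monomial of top weight in \<open>f\<close>, and top weights in
  \<open>\<Sum>\<^sub>l s\<^sub>l\<^sup>2 + f \<Sum>\<^sub>l t\<^sub>l\<^sup>2\<close> cannot cancel. So if \<open>h\<close> has weight at most \<open>2Wn\<close>, each \<open>s\<^sub>l\<close> has weight at
  most \<open>Wn\<close> and each \<open>t\<^sub>l\<close> has weight strictly below \<open>Wn\<close>, because \<open>f\<close> is not constant
  (\<open>weight_lt_of_sum_of_squares\<close>). Secondly, \<open>f\<close> is positive on arbitrarily large rectangular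
  grids (\<open>ex_positive_grid\<close>), and where \<open>h\<close> vanishes and \<open>f\<close> is positive, all \<open>s\<^sub>l\<close> and \<open>t\<^sub>l\<close> vanish.

  Choose such a grid \<open>(u\<^sub>a, v\<^sub>b)\<close> and let \<open>h\<close> be the sum of the squares of
  \<open>q\<^sub>j = \<Prod>\<^bsub>a < W(n - j)\<^esub> (x - u\<^sub>a) \<cdot> \<Prod>\<^bsub>b < j\<^esub> (y - v\<^sub>b)\<close> for \<open>j \<le> n\<close>. All \<open>q\<^sub>j\<close> vanish on the staircase of
  grid points with \<open>b < n\<close> and \<open>a < W(n - b)\<close>. A polynomial of weight below \<open>Wn\<close> that vanishes
  there is zero, and one of weight at most \<open>Wn\<close> is a real linear combination of the \<open>q\<^sub>j\<close>
  (\<open>vanish_staircase_weight_lt_imp_0\<close>, \<open>vanish_staircase_in_span\<close>). Hence all \<open>t\<^sub>l\<close> are zero and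
  \<open>s\<^sub>l = \<Sum>\<^sub>j c\<^sub>l\<^sub>j q\<^sub>j\<close>. The products \<open>q\<^sub>i q\<^sub>j\<close> with \<open>i \<le> j\<close> are linearly independent
  (\<open>grid_basis_gram_unique\<close>), so comparing \<open>\<Sum>\<^sub>l s\<^sub>l\<^sup>2\<close> with \<open>\<Sum>\<^sub>j q\<^sub>j\<^sup>2\<close> shows that the \<open>n + 1\<close> columns
  of \<open>c\<close> are orthonormal vectors, and there must be at least \<open>n + 1\<close> indices \<open>l\<close>.
\<close>

section \<open>Weighted degree\<close>

abbreviation eval2 :: "real poly poly \<Rightarrow> real \<Rightarrow> real \<Rightarrow> real" where
  "eval2 p x y \<equiv> poly (poly p [:y:]) x"

text \<open>
  The weight gives \<open>x\<close> degree 1 and \<open>y\<close> degree \<open>W\<close>. The bound is strict so that the two bounds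
  ``at most \<open>Wn\<close>'' and ``below \<open>Wn\<close>'' that the proof distinguishes are both instances.
\<close>

definition weight_lt :: "nat \<Rightarrow> nat \<Rightarrow> real poly poly \<Rightarrow> bool" where
  "weight_lt W D p \<longleftrightarrow> (\<forall>i j. coeff (coeff p j) i \<noteq> 0 \<longrightarrow> i + W * j < D)"

text \<open>
  The offset \<open>K\<close>, which makes this and the next lemma inductive, is the weight of the power of \<open>y\<close>
  already split off: passing from \<open>pCons a p\<close> to \<open>p\<close> raises it by \<open>W\<close>.
\<close>

lemma weight_restriction_to_line:
  assumes "\<And>i j. coeff (coeff p j) i \<noteq> 0 \<Longrightarrow> i + W * j + K < D" and "coeff (poly p [:y:]) i \<noteq> 0"
  shows "i + K < D"
  using assms
proof (induction p arbitrary: K i)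
  case 0
  then show ?case by simp
next
  case (pCons a p)
  show ?case
  proof (cases "coeff a i = 0")
    case False
    then show ?thesis using pCons.prems(1)[of 0 i] by simp
  next
    case True
    then have "coeff (poly p [:y:]) i \<noteq> 0"
      using pCons.prems(2) by auto
    moreover have "i + W * j + (K + W) < D" if "coeff (coeff p j) i \<noteq> 0" for i j
      using pCons.prems(1)[of "Suc j" i] that by (simp add: algebra_simps)
    ultimately show ?thesis
      using pCons.IH[of "K + W" i] by simp
  qed
qed

lemma weight_synthetic_div_offset:
  assumes "\<And>i j. coeff (coeff p j) i \<noteq> 0 \<Longrightarrow> i + W * j + K < D"
    and "coeff (coeff (synthetic_div p [:y:]) j) i \<noteq> 0"
  shows "i + W * j + W + K < D"
  using assms
proof (induction p arbitrary: K j)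
  case 0
  then show ?case by simp
next
  case (pCons a p)
  have *: "i + W * j + (K + W) < D" if "coeff (coeff p j) i \<noteq> 0" for i j
    using pCons.prems(1)[of "Suc j" i] that by (simp add: algebra_simps)
  show ?case
  proof (cases j)
    case 0
    then have "coeff (poly p [:y:]) i \<noteq> 0" using pCons.prems(2) by simp
    from weight_restriction_to_line[OF * this] show ?thesis using 0 by simp
  next
    case (Suc k)
    then have "coeff (coeff (synthetic_div p [:y:]) k) i \<noteq> 0" using pCons.prems(2) by simp
    from pCons.IH[OF * this] show ?thesis using Suc by (simp add: algebra_simps)
  qed
qed

lemma weight_lt_synthetic_div:
  assumes "weight_lt W (D + W) p"
  shows "weight_lt W D (synthetic_div p [:y:])"
  unfolding weight_lt_def
proof (intro allI impI)
  fix i j assume "coeff (coeff (synthetic_div p [:y:]) j) i \<noteq> 0"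
  from weight_synthetic_div_offset[OF _ this, of W 0 "D + W"] assms
  show "i + W * j < D" by (simp add: weight_lt_def)
qed

lemma weight_lt_coeff_restriction:
  assumes "weight_lt W D p" "i \<ge> D"
  shows "coeff (poly p [:y:]) i = 0"
  using weight_restriction_to_line[of p W 0 D y i] assms by (auto simp: weight_lt_def)

lemma weight_lt_mult:
  assumes "weight_lt W (Suc D) p" "weight_lt W (Suc E) q"
  shows "weight_lt W (Suc (D + E)) (p * q)"
  unfolding weight_lt_def
proof (intro allI impI)
  fix i j assume "coeff (coeff (p * q) j) i \<noteq> 0"
  then have "(\<Sum>k\<le>j. \<Sum>l\<le>i. coeff (coeff p k) l * coeff (coeff q (j - k)) (i - l)) \<noteq> 0"
    by (simp add: coeff_mult coeff_sum)
  then obtain k where "k \<le> j" and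
    "(\<Sum>l\<le>i. coeff (coeff p k) l * coeff (coeff q (j - k)) (i - l)) \<noteq> 0"
    by (meson atMost_iff sum.not_neutral_contains_not_neutral)
  then obtain l where l: "l \<le> i" "coeff (coeff p k) l * coeff (coeff q (j - k)) (i - l) \<noteq> 0"
    by (meson atMost_iff sum.not_neutral_contains_not_neutral)
  then have "l + W * k < Suc D" "(i - l) + W * (j - k) < Suc E"
    using assms unfolding weight_lt_def by (metis mult_eq_0_iff)+
  moreover have "W * j = W * k + W * (j - k)"
    using \<open>k \<le> j\<close> by (simp flip: distrib_left)
  ultimately show "i + W * j < Suc (D + E)" using l(1) by linarith
qed

section \<open>Polynomials vanishing on a staircase of grid points\<close>

definition grid_x :: "nat \<Rightarrow> (nat \<Rightarrow> real) \<Rightarrow> nat \<Rightarrow> real poly" where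
  "grid_x W u i = (\<Prod>a<W * i. [:- u a, 1:])"

definition grid_y :: "(nat \<Rightarrow> real) \<Rightarrow> nat \<Rightarrow> real poly poly" where
  "grid_y v j = (\<Prod>b<j. [:[:- v b:], 1:])"

definition grid_basis ::
    "nat \<Rightarrow> (nat \<Rightarrow> real) \<Rightarrow> (nat \<Rightarrow> real) \<Rightarrow> nat \<Rightarrow> nat \<Rightarrow> real poly poly" where
  "grid_basis W u v n j = [:grid_x W u (n - j):] * grid_y v j"

lemma degree_grid_x: "degree (grid_x W u i) = W * i"
  unfolding grid_x_def by (subst degree_prod_eq_sum_degree) auto

lemma lead_coeff_grid_x: "coeff (grid_x W u i) (W * i) = 1"
proof -
  have "lead_coeff (grid_x W u i) = 1"
    unfolding grid_x_def by (simp add: lead_coeff_prod)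
  then show ?thesis by (simp add: degree_grid_x)
qed

lemma poly_grid_x_eq_0_iff:
  assumes "inj u"
  shows "poly (grid_x W u i) (u a) = 0 \<longleftrightarrow> a < W * i"
  unfolding grid_x_def using injD[OF assms] by (auto simp: poly_prod)

lemma eval2_grid_y_eq_0_iff:
  assumes "inj v"
  shows "eval2 (grid_y v j) x (v b) = 0 \<longleftrightarrow> b < j"
  unfolding grid_y_def using injD[OF assms] by (auto simp: poly_prod)

lemma eval2_grid_basis_eq_0_iff:
  assumes "inj u" "inj v"
  shows "eval2 (grid_basis W u v n j) (u a) (v b) = 0 \<longleftrightarrow> a < W * (n - j) \<or> b < j"
  by (simp add: grid_basis_def poly_grid_x_eq_0_iff[OF assms(1)] eval2_grid_y_eq_0_iff[OF assms(2)])

lemma grid_basis_0: "grid_basis W u v n 0 = [:grid_x W u n:]"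
  by (simp add: grid_basis_def grid_y_def)

lemma grid_basis_Suc:
  "grid_basis W u v (Suc n) (Suc j) = [:[:- v 0:], 1:] * grid_basis W u (\<lambda>b. v (Suc b)) n j"
  unfolding grid_basis_def grid_y_def prod.lessThan_Suc_shift
  by (simp only: diff_Suc_Suc o_def mult.left_commute)

lemma weight_lt_grid_basis:
  assumes "j \<le> n"
  shows "weight_lt W (Suc (W * n)) (grid_basis W u v n j)"
proof -
  have x: "weight_lt W (Suc (W * i)) [:grid_x W u i:]" for i
    unfolding weight_lt_def
  proof (intro allI impI)
    fix k l assume "coeff (coeff [:grid_x W u i:] l) k \<noteq> 0"
    then have "l = 0" "coeff (grid_x W u i) k \<noteq> 0"
      by (simp_all add: coeff_pCons split: nat.splits)
    then show "k + W * l < Suc (W * i)"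
      using le_degree[of "grid_x W u i" k] by (simp add: degree_grid_x)
  qed
  have y: "weight_lt W (Suc (W * j)) (grid_y v j)" for j
  proof (induction j)
    case 0
    then show ?case by (auto simp: weight_lt_def grid_y_def one_pCons coeff_pCons split: nat.splits)
  next
    case (Suc j)
    have "weight_lt W (Suc W) [:[:- v j:], 1:]"
      by (auto simp: weight_lt_def one_pCons coeff_pCons split: nat.splits)
    from weight_lt_mult[OF Suc this] show ?case
      by (simp only: grid_y_def prod.lessThan_Suc mult_Suc_right add.commute)
  qed
  from weight_lt_mult[OF x[of "n - j"] y[of j]] show ?thesis
    using assms unfolding grid_basis_def by (simp flip: distrib_left)
qed

text \<open>
  The step that removes the line through one row of grid points; both staircase lemmas below
  iterate it.
\<close>

lemma split_at_line:
  fixes p :: "real poly poly" and y x z :: real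
  defines "r \<equiv> poly p [:y:]" and "p' \<equiv> synthetic_div p [:y:]"
  shows "p = [:[:- y:], 1:] * p' + [:r:]" and "eval2 p x z = (z - y) * eval2 p' x z + poly r x"
proof -
  show *: "p = [:[:- y:], 1:] * p' + [:r:]"
    using synthetic_div_correct'[of "[:y:]" p] by (simp add: r_def p'_def)
  show "eval2 p x z = (z - y) * eval2 p' x z + poly r x"
    by (subst *) (simp add: algebra_simps)
qed

text \<open>
  On the lowest row, the restriction of \<open>p\<close> has degree below \<open>Wn\<close> and \<open>Wn\<close> roots, so it is zero
  and \<open>p\<close> is divisible by the equation of that row. The quotient has weight smaller by \<open>W\<close> and
  vanishes on the rest of the staircase, which is the staircase for \<open>n - 1\<close>.
\<close>

lemma vanish_staircase_weight_lt_imp_0: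
  assumes "inj u" "inj v" and "weight_lt W (W * n) p"
    and "\<And>a b. b < n \<Longrightarrow> a < W * (n - b) \<Longrightarrow> eval2 p (u a) (v b) = 0"
  shows "p = 0"
  using assms
proof (induction n arbitrary: v p)
  case 0
  then show ?case by (auto simp: weight_lt_def poly_eq_iff)
next
  case (Suc n)
  define r p' where "r = poly p [:v 0:]" and "p' = synthetic_div p [:v 0:]"
  note split = split_at_line[where p = p and y = "v 0", folded r_def p'_def]
  have root: "poly r (u a) = 0" if "a < W * Suc n" for a
    using Suc.prems(4)[of 0 a] that by (simp add: r_def)
  have "r = 0"
  proof (cases "W * Suc n")
    case 0
    with Suc.prems(3) weight_lt_coeff_restriction show ?thesis
      by (metis r_def poly_eqI coeff_0 le0)
  next
    case (Suc N)
    show ?thesis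
    proof (rule poly_eqI_degree[of "u ` {..<W * Suc n}"])
      have "degree r \<le> N"
        using weight_lt_coeff_restriction[OF Suc.prems(3)] Suc
        by (intro degree_le) (auto simp: r_def)
      then show "degree r < card (u ` {..<W * Suc n})" 
        using Suc Suc.prems(1) by (simp add: card_image inj_on_subset del: mult_Suc_right)
      then show "degree (0::real poly) < card (u ` {..<W * Suc n})" by simp
    qed (use root in auto)
  qed
  moreover have "p' = 0"
  proof (rule Suc.IH)
    show "inj u" by fact
    show "inj (\<lambda>b. v (Suc b))" using Suc.prems(2) by (auto simp: inj_def)
    show "weight_lt W (W * n) p'"
      unfolding p'_def using Suc.prems(3) by (intro weight_lt_synthetic_div) (simp add: add.commute)
    fix a b assume ab: "b < n" "a < W * (n - b)"
    have "v (Suc b) \<noteq> v 0" using injD[OF Suc.prems(2)] by blast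
    moreover have "eval2 p (u a) (v (Suc b)) = 0"
      using Suc.prems(4)[of "Suc b" a] ab by simp
    ultimately show "eval2 p' (u a) (v (Suc b)) = 0"
      using split(2)[where x = "u a" and z = "v (Suc b)"] \<open>r = 0\<close> by simp
  qed
  ultimately show ?case using split(1) by simp
qed

text \<open>
  The same induction with one more degree of freedom: the restriction to the lowest row may now
  have degree exactly \<open>Wn\<close>, so it is a multiple of the polynomial with these \<open>Wn\<close> simple roots,
  which is the basis element with index 0.
\<close>

lemma vanish_staircase_in_span:
  assumes "inj u" "inj v" "W > 0" and "weight_lt W (Suc (W * n)) p"
    and "\<And>a b. b < n \<Longrightarrow> a < W * (n - b) \<Longrightarrow> eval2 p (u a) (v b) = 0"
  shows "\<exists>c. p = (\<Sum>j\<le>n. [:[:c j:]:] * grid_basis W u v n j)"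
  using assms
proof (induction n arbitrary: v p)
  case 0
  define e where "e = coeff (coeff p 0) 0"
  have "coeff (coeff p j) i = coeff (coeff [:[:e:]:] j) i" for i j
  proof (cases "i = 0 \<and> j = 0")
    case False
    then have "\<not> i + W * j < 1" using \<open>W > 0\<close> by simp
    then have "coeff (coeff p j) i = 0" using 0(4) unfolding weight_lt_def by auto
    with False show ?thesis by (cases j; cases i) simp_all
  qed (simp add: e_def)
  then have "p = [:[:e:]:]" by (simp add: poly_eq_iff)
  then show ?case
    by (intro exI[of _ "\<lambda>_. e"]) (simp add: grid_basis_def grid_x_def grid_y_def one_pCons)
next
  case (Suc n)
  define r p' where "r = poly p [:v 0:]" and "p' = synthetic_div p [:v 0:]"
  note split = split_at_line[where p = p and y = "v 0", folded r_def p'_def]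
  have root: "poly r (u a) = 0" if "a < W * Suc n" for a
    using Suc.prems(5)[of 0 a] that by (simp add: r_def)
  define e where "e = coeff r (W * Suc n)"
  have r: "r = smult e (grid_x W u (Suc n))"
  proof (rule poly_eqI_degree_lead_coeff[of _ "W * Suc n" _ "u ` {..<W * Suc n}"])
    show "degree r \<le> W * Suc n"
      using weight_lt_coeff_restriction[OF Suc.prems(4)]
      by (intro degree_le) (auto simp: r_def)
    show "card (u ` {..<W * Suc n}) \<ge> W * Suc n"
      using Suc.prems(1) by (simp add: card_image inj_on_subset del: mult_Suc_right)
    show "coeff r (W * Suc n) = coeff (smult e (grid_x W u (Suc n))) (W * Suc n)"
      by (simp add: e_def lead_coeff_grid_x del: mult_Suc_right)
    show "degree (smult e (grid_x W u (Suc n))) \<le> W * Suc n"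
      using degree_smult_le[of e "grid_x W u (Suc n)"] by (simp add: degree_grid_x)
  qed (use root poly_grid_x_eq_0_iff[OF Suc.prems(1)] in auto)
  have "\<exists>c. p' = (\<Sum>j\<le>n. [:[:c j:]:] * grid_basis W u (\<lambda>b. v (Suc b)) n j)"
  proof (rule Suc.IH)
    show "inj u" "W > 0" by fact+
    show "inj (\<lambda>b. v (Suc b))" using Suc.prems(2) by (auto simp: inj_def)
    show "weight_lt W (Suc (W * n)) p'"
      unfolding p'_def using Suc.prems(4) by (intro weight_lt_synthetic_div) (simp add: add.commute)
    fix a b assume ab: "b < n" "a < W * (n - b)"
    have "v (Suc b) \<noteq> v 0" using injD[OF Suc.prems(2)] by blast
    moreover have "eval2 p (u a) (v (Suc b)) = 0"
      using Suc.prems(5)[of "Suc b" a] ab by simp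
    moreover have "W * (n - b) \<le> W * Suc n" by (rule mult_le_mono2) simp
    then have "poly r (u a) = 0" using ab(2) by (intro root) linarith
    ultimately show "eval2 p' (u a) (v (Suc b)) = 0"
      using split(2)[where x = "u a" and z = "v (Suc b)"] by simp
  qed
  then obtain c where c: "p' = (\<Sum>j\<le>n. [:[:c j:]:] * grid_basis W u (\<lambda>b. v (Suc b)) n j)" ..
  define c' where "c' = (\<lambda>j. case j of 0 \<Rightarrow> e | Suc j \<Rightarrow> c j)"
  have "(\<Sum>j\<le>Suc n. [:[:c' j:]:] * grid_basis W u v (Suc n) j) =
      [:[:e:]:] * [:grid_x W u (Suc n):] + [:[:- v 0:], 1:] * p'"
    unfolding sum.atMost_Suc_shift grid_basis_0 grid_basis_Suc c sum_distrib_left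
    by (simp add: c'_def mult.left_commute)
  also have "\<dots> = p" using split(1) r by simp
  finally show ?case by metis
qed

section \<open>No cancellation of top weights\<close>

text \<open>
  The substitution \<open>x = t\<^sup>T\<close>, \<open>y = t\<^bsup>TW + 1\<^esup>\<close>. It sends a monomial of weight \<open>w\<close> and \<open>y\<close>-degree
  \<open>j\<close> to \<open>t\<^bsup>Tw + j\<^esup>\<close>, so for large \<open>T\<close> it keeps monomials apart and orders them by weight first.
\<close>

definition kronecker :: "nat \<Rightarrow> nat \<Rightarrow> real poly poly \<Rightarrow> real poly" where
  "kronecker T W p =
     (\<Sum>j\<le>degree p. \<Sum>i\<le>degree (coeff p j). monom (coeff (coeff p j) i) (T * (i + W * j) + j))"

lemma poly_kronecker: "poly (kronecker T W p) t = eval2 p (t ^ T) (t ^ (T * W + 1))"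
proof -
  have "eval2 p (t ^ T) (t ^ (T * W + 1)) =
      (\<Sum>j\<le>degree p. poly (coeff p j) (t ^ T) * (t ^ (T * W + 1)) ^ j)"
    by (subst poly_altdef[of p]) (simp add: poly_sum)
  also have "\<dots> = (\<Sum>j\<le>degree p. \<Sum>i\<le>degree (coeff p j).
      coeff (coeff p j) i * (t ^ T) ^ i * (t ^ (T * W + 1)) ^ j)"
    by (subst poly_altdef) (simp add: sum_distrib_right)
  also have "\<dots> = poly (kronecker T W p) t"
    unfolding kronecker_def poly_sum poly_monom
    by (intro sum.cong refl) (simp add: power_mult[symmetric] power_add[symmetric] algebra_simps)
  finally show ?thesis ..
qed

lemma degree_kronecker_le:
  assumes "\<And>i j. coeff (coeff p j) i \<noteq> 0 \<Longrightarrow> T * (i + W * j) + j \<le> N"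
  shows "degree (kronecker T W p) \<le> N"
  unfolding kronecker_def
proof (intro degree_sum_le)
  fix i j
  show "degree (monom (coeff (coeff p j) i) (T * (i + W * j) + j)) \<le> N"
    using assms[of j i] by (cases "coeff (coeff p j) i = 0") (simp_all add: degree_monom_eq)
qed auto

text \<open>
  The exponent determines \<open>j\<close> as its residue modulo \<open>T\<close>, and then \<open>i\<close>.
\<close>

lemma coeff_kronecker:
  assumes "degree p < T" "coeff (coeff p j) i \<noteq> 0"
  shows "coeff (kronecker T W p) (T * (i + W * j) + j) = coeff (coeff p j) i"
proof -
  have "coeff p j \<noteq> 0" using assms(2) by auto
  then have j: "j \<le> degree p" by (rule le_degree)
  have i: "i \<le> degree (coeff p j)" using assms(2) by (rule le_degree)
  have eq: "T * (i' + W * j') + j' = T * (i + W * j) + j \<longleftrightarrow> j' = j \<and> i' = i"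
    if "j' \<le> degree p" for i' j'
  proof
    assume *: "T * (i' + W * j') + j' = T * (i + W * j) + j"
    have "j' = (T * (i' + W * j') + j') mod T" using that assms(1) by simp
    also have "\<dots> = j" unfolding * using j assms(1) by simp
    finally have "j' = j" .
    with * assms(1) show "j' = j \<and> i' = i" by simp
  qed auto
  have "coeff (kronecker T W p) (T * (i + W * j) + j) =
     (\<Sum>j'\<le>degree p. \<Sum>i'\<le>degree (coeff p j').
        if j' = j then if i' = i then coeff (coeff p j') i' else 0 else 0)"
    unfolding kronecker_def coeff_sum coeff_monom
    by (intro sum.cong refl) (auto simp: eq)
  also have "\<dots> = (\<Sum>j'\<le>degree p. if j' = j then
        (\<Sum>i'\<le>degree (coeff p j'). if i' = i then coeff (coeff p j') i' else 0) else 0)"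
    by (intro sum.cong refl) simp
  also have "\<dots> = coeff (coeff p j) i"
    using i j by simp
  finally show ?thesis .
qed

lemma exponent_le_degree_kronecker:
  assumes "degree p < T" "coeff (coeff p j) i \<noteq> 0"
  shows "T * (i + W * j) + j \<le> degree (kronecker T W p)"
  using coeff_kronecker[OF assms] assms(2) by (intro le_degree) simp

lemma degree_le_if_eventually_le:
  fixes p q :: "real poly"
  assumes "\<And>t. t \<ge> t0 \<Longrightarrow> 0 \<le> poly p t" "\<And>t. t \<ge> t0 \<Longrightarrow> poly p t \<le> poly q t"
  shows "degree p \<le> degree q"
proof (rule ccontr)
  assume "\<not> degree p \<le> degree q"
  then have deg: "degree q < degree p" by simp
  then have "p \<noteq> 0" by auto
  have no: "False" if r: "lead_coeff r > 0" "\<And>t. t \<ge> t0 \<Longrightarrow> poly r t \<le> 0" for r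
  proof -
    obtain n where "\<forall>x\<ge>n. poly r x \<ge> lead_coeff r"
      using poly_pinfty_gt_lc[OF r(1)] by blast
    then have "poly r (max n t0) > 0" using r(1) by (metis less_le_trans max.cobounded1)
    with r(2)[of "max n t0"] show False by simp
  qed
  show False
  proof (cases "lead_coeff p > 0")
    case True
    have "lead_coeff (p - q) = lead_coeff p"
      using lead_coeff_add_le[of "- q" p] deg by (simp add: coeff_eq_0 degree_diff_less)
    then show False
      using no[of "p - q"] True assms(2) by simp
  next
    case False
    with \<open>p \<noteq> 0\<close> have "lead_coeff (- p) > 0"
      by (simp add: order_less_le)
    then show False using no[of "- p"] assms(1) by simp
  qed
qed

text \<open>
  Along the curve of the Kronecker substitution \<open>f\<close> is eventually positive, so each \<open>s\<^sub>l\<^sup>2\<close> and each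
  \<open>f t\<^sub>l\<^sup>2\<close> is squeezed between 0 and \<open>h\<close> there. Growth for large parameters compares degrees, and
  for large \<open>T\<close> degrees determine weights.
\<close>

lemma weight_lt_of_sum_of_squares:
  fixes f h :: "real poly poly" and s t :: "nat \<Rightarrow> real poly poly"
  assumes pos: "lead_coeff (lead_coeff f) > 0"
    and nonconst: "degree f \<noteq> 0 \<or> degree (lead_coeff f) \<noteq> 0"
    and W: "\<And>j. degree (coeff f j) < W"
    and h: "h = (\<Sum>l<m. s l ^ 2) + f * (\<Sum>l<m. t l ^ 2)"
    and wh: "weight_lt W (Suc (2 * D)) h"
    and l: "l < m"
  shows "weight_lt W (Suc D) (s l)" "weight_lt W D (t l)"
proof -
  \<comment> \<open>Larger than every \<open>y\<close>-degree involved; exceeding that of \<open>h\<close> makes \<open>cancel\<close> below work.\<close>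
  define T where "T = Suc (degree h + degree f + degree (s l) + degree (t l))"
  define d b where "d = degree f" and "b = degree (lead_coeff f)"
  let ?K = "kronecker T W"
  have top_pos: "coeff (coeff f d) b > 0"
    using pos by (simp add: d_def b_def)
  then have top: "coeff (coeff f d) b \<noteq> 0" by simp
  have "degree (?K f) \<le> T * (b + W * d) + d"
  proof (rule degree_kronecker_le)
    fix i j assume ij: "coeff (coeff f j) i \<noteq> 0"
    then have "coeff f j \<noteq> 0" by auto
    then have "j \<le> d" unfolding d_def by (rule le_degree)
    have "i + W * j \<le> b + W * d"
    proof (cases "j = d")
      case True
      with ij show ?thesis by (auto simp: b_def d_def le_degree)
    next
      case False
      with \<open>j \<le> d\<close> have "Suc j \<le> d" by simp
      then have "W * Suc j \<le> W * d" by (rule mult_le_mono2)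
      moreover have "i < W" using le_degree[OF ij] W[of j] by simp
      ultimately show ?thesis by simp
    qed
    from add_mono[OF mult_le_mono2[OF this] \<open>j \<le> d\<close>]
    show "T * (i + W * j) + j \<le> T * (b + W * d) + d" .
  qed
  moreover have "T * (b + W * d) + d \<le> degree (?K f)"
    using top by (intro exponent_le_degree_kronecker) (simp_all add: T_def)
  ultimately have deg_f: "degree (?K f) = T * (b + W * d) + d" by simp
  have "lead_coeff (?K f) > 0"
    unfolding deg_f using top_pos by (subst coeff_kronecker[OF _ top]) (simp_all add: T_def)
  then obtain t0 where t0: "\<And>x. x \<ge> t0 \<Longrightarrow> poly (?K f) x > 0"
    using poly_pinfty_gt_lc[of "?K f"] by (meson less_le_trans)
  have ev: "poly (?K h) x = (\<Sum>l<m. (poly (?K (s l)) x)\<^sup>2) +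
      poly (?K f) x * (\<Sum>l<m. (poly (?K (t l)) x)\<^sup>2)" for x
    unfolding poly_kronecker by (simp add: h poly_sum)
  have sum_ge: "(poly (?K (r l)) x)\<^sup>2 \<le> (\<Sum>l<m. (poly (?K (r l)) x)\<^sup>2)" for r x
    using l by (intro member_le_sum) auto
  have sum_nonneg: "0 \<le> (\<Sum>l<m. (poly (?K (r l)) x)\<^sup>2)" for r :: "nat \<Rightarrow> real poly poly" and x
    by (intro sum_nonneg) auto
  have deg_s: "degree (?K (s l) ^ 2) \<le> degree (?K h)"
  proof (rule degree_le_if_eventually_le[of t0])
    fix x assume x: "x \<ge> t0"
    show "poly (?K (s l) ^ 2) x \<le> poly (?K h) x"
      using ev[of x] sum_ge[of s x] mult_nonneg_nonneg[OF less_imp_le[OF t0[OF x]] sum_nonneg[of t x]]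
      by simp
  qed simp
  have deg_t: "degree (?K f * ?K (t l) ^ 2) \<le> degree (?K h)"
  proof (rule degree_le_if_eventually_le[of t0])
    fix x assume x: "x \<ge> t0"
    then show "0 \<le> poly (?K f * ?K (t l) ^ 2) x" using t0[OF x] by simp
    show "poly (?K f * ?K (t l) ^ 2) x \<le> poly (?K h) x"
      using ev[of x] sum_nonneg[of s x] mult_left_mono[OF sum_ge[of t x] less_imp_le[OF t0[OF x]]]
      by simp
  qed
  have deg_h: "degree (?K h) \<le> T * (2 * D) + degree h"
  proof (rule degree_kronecker_le)
    fix i j assume ij: "coeff (coeff h j) i \<noteq> 0"
    then have "coeff h j \<noteq> 0" by auto
    then have "j \<le> degree h" by (rule le_degree)
    moreover have "i + W * j \<le> 2 * D" using ij wh by (auto simp: weight_lt_def less_Suc_eq_le)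
    ultimately show "T * (i + W * j) + j \<le> T * (2 * D) + degree h"
      by (intro add_mono mult_le_mono2)
  qed
  have cancel: "n \<le> 2 * D" if "T * n \<le> T * (2 * D) + degree h" for n
  proof -
    have "T * n < T * Suc (2 * D)" using that by (simp add: T_def)
    then have "n < Suc (2 * D)" using mult_less_cancel1 by blast
    then show ?thesis by simp
  qed
  have halve: "y < D" if "x + 2 * y \<le> 2 * D" "x \<noteq> 0" for x y :: nat
    using that by linarith
  show "weight_lt W (Suc D) (s l)"
    unfolding weight_lt_def
  proof (intro allI impI)
    fix i j assume "coeff (coeff (s l) j) i \<noteq> 0"
    then have "T * (i + W * j) + j \<le> degree (?K (s l))"
      by (intro exponent_le_degree_kronecker) (simp_all add: T_def)
    moreover have "2 * degree (?K (s l)) \<le> T * (2 * D) + degree h"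
      using deg_s deg_h by (cases "?K (s l) = 0") (simp_all add: degree_power_eq)
    ultimately have "2 * (T * (i + W * j)) \<le> T * (2 * D) + degree h" by linarith
    then have "T * (2 * (i + W * j)) \<le> T * (2 * D) + degree h" by (simp only: mult.left_commute)
    from cancel[OF this] show "i + W * j < Suc D" by simp
  qed
  show "weight_lt W D (t l)"
    unfolding weight_lt_def
  proof (intro allI impI)
    fix i j assume ij: "coeff (coeff (t l) j) i \<noteq> 0"
    have *: "T * (i + W * j) + j \<le> degree (?K (t l))"
      using ij by (intro exponent_le_degree_kronecker) (simp_all add: T_def)
    have "coeff (?K (t l)) (T * (i + W * j) + j) \<noteq> 0"
      using ij by (subst coeff_kronecker) (simp_all add: T_def)
    then have "?K (t l) \<noteq> 0" by auto
    moreover have "?K f \<noteq> 0" using \<open>lead_coeff (?K f) > 0\<close> by auto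
    ultimately have "degree (?K f * ?K (t l) ^ 2) = degree (?K f) + 2 * degree (?K (t l))"
      by (simp add: degree_mult_eq degree_power_eq)
    then have "T * (b + W * d) + 2 * (T * (i + W * j)) \<le> T * (2 * D) + degree h"
      using deg_t deg_h * deg_f by linarith
    then have "T * ((b + W * d) + 2 * (i + W * j)) \<le> T * (2 * D) + degree h"
      by (simp add: algebra_simps)
    then have "(b + W * d) + 2 * (i + W * j) \<le> 2 * D" by (rule cancel)
    moreover have "b + W * d \<noteq> 0"
      using nonconst W[of 0] by (auto simp: b_def d_def)
    ultimately show "i + W * j < D"
      using halve[of "b + W * d" "i + W * j"] by blast
  qed
qed

section \<open>Uniqueness of the Gram matrix\<close>

text \<open>
  At the point \<open>(u\<^bsub>W(n - i)\<^esub>, v\<^sub>k)\<close> only the basis elements with index between \<open>i\<close> and \<open>k\<close> are nonzero.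
  Going through the entries in order of increasing distance \<open>k - i\<close> from the diagonal, the value
  at this point has the entries \<open>(i, k)\<close> and \<open>(k, i)\<close> as its only unknowns.
\<close>

lemma grid_basis_gram_unique:
  assumes "inj u" "inj v" "W > 0" and sym: "\<And>r s. g r s = g s r"
    and zero: "\<And>x y. (\<Sum>r\<le>n. \<Sum>s\<le>n. g r s *
      (eval2 (grid_basis W u v n r) x y * eval2 (grid_basis W u v n s) x y)) = 0"
    and "i \<le> k" "k \<le> n"
  shows "g i k = (0::real)"
  using \<open>i \<le> k\<close> \<open>k \<le> n\<close>
proof (induction "k - i" arbitrary: i k rule: less_induct)
  case less
  define e where "e r = eval2 (grid_basis W u v n r) (u (W * (n - i))) (v k)" for r
  have e: "e r \<noteq> 0 \<longleftrightarrow> i \<le> r \<and> r \<le> k" if "r \<le> n" for r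
    unfolding e_def eval2_grid_basis_eq_0_iff[OF assms(1,2)]
    using \<open>W > 0\<close> that less.prems by auto
  have vanish: "g r s * (e r * e s) = 0" if rs: "r \<le> n" "s \<le> n" "(r, s) \<noteq> (i, k)" "(r, s) \<noteq> (k, i)" for r s
  proof (cases "e r \<noteq> 0 \<and> e s \<noteq> 0")
    case True
    then have *: "i \<le> r" "r \<le> k" "i \<le> s" "s \<le> k" using e rs by auto
    show ?thesis
    proof (cases "r \<le> s")
      case True
      then have "s - r < k - i" using * rs by auto
      then have "g r s = 0" using True rs by (intro less.hyps) auto
      then show ?thesis by simp
    next
      case False
      then have "r - s < k - i" using * rs by auto
      then have "g s r = 0" using False rs by (intro less.hyps) auto
      then show ?thesis using sym[of r s] by simp
    qed
  qed auto
  have "0 = (\<Sum>(r, s)\<in>{..n} \<times> {..n}. g r s * (e r * e s))"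
    using zero[where x = "u (W * (n - i))" and y = "v k"] by (simp add: e_def sum.cartesian_product)
  also have "\<dots> = (\<Sum>(r, s)\<in>{(i, k), (k, i)}. g r s * (e r * e s))"
  proof (rule sum.mono_neutral_right)
    show "\<forall>z\<in>{..n} \<times> {..n} - {(i, k), (k, i)}. (case z of (r, s) \<Rightarrow> g r s * (e r * e s)) = 0"
      using vanish by fast
  qed (use less.prems in auto)
  also have "\<dots> = (if i = k then 1 else 2) * (g i k * (e i * e k))"
    using sym[of i k] by simp
  finally have "g i k * (e i * e k) = 0" by (auto split: if_splits)
  moreover have "e i \<noteq> 0" "e k \<noteq> 0" using e less.prems by auto
  ultimately show "g i k = 0" by simp
qed

text \<open>
  By Bessel's inequality, the projection of each of the \<open>m\<close> standard basis vectors to the span of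
  the columns of \<open>c\<close> has squared length at most 1, and these squared lengths add up to \<open>n\<close>.
\<close>

lemma orthonormal_card_le:
  fixes c :: "nat \<Rightarrow> nat \<Rightarrow> real"
  assumes orth: "\<And>i j. i < n \<Longrightarrow> j < n \<Longrightarrow> (\<Sum>l<m. c l i * c l j) = (if i = j then 1 else 0)"
  shows "n \<le> m"
proof -
  define S where "S l = (\<Sum>j<n. (c l j)\<^sup>2)" for l
  have le1: "S l \<le> 1" if "l < m" for l
  proof -
    \<comment> \<open>The projection of the \<open>l\<close>-th standard basis vector to the span of the columns.\<close>
    define w where "w k = (\<Sum>j<n. c l j * c k j)" for k
    have "S l = w l" by (simp add: S_def w_def power2_eq_square)
    have "(S l)\<^sup>2 \<le> (\<Sum>k<m. (w k)\<^sup>2)"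
      unfolding \<open>S l = w l\<close> using that by (intro member_le_sum) auto
    also have "\<dots> = (\<Sum>k<m. \<Sum>i<n. \<Sum>j<n. c l i * c l j * (c k i * c k j))"
      by (simp add: w_def power2_eq_square sum_product algebra_simps)
    also have "\<dots> = (\<Sum>i<n. \<Sum>j<n. \<Sum>k<m. c l i * c l j * (c k i * c k j))"
      by (subst sum.swap) (intro sum.cong refl sum.swap)
    also have "\<dots> = (\<Sum>i<n. \<Sum>j<n. if i = j then c l i * c l j else 0)"
      by (intro sum.cong refl) (simp add: orth flip: sum_distrib_left)
    also have "\<dots> = S l" by (simp add: S_def power2_eq_square)
    finally have "S l * S l \<le> S l" by (simp add: power2_eq_square)
    then show ?thesis using mult_strict_left_mono[of 1 "S l" "S l"] by fastforce
  qed
  have "real n = (\<Sum>j<n. \<Sum>l<m. c l j * c l j)" by (simp add: orth)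
  also have "\<dots> = (\<Sum>l<m. S l)" by (subst sum.swap) (simp add: S_def power2_eq_square)
  also have "\<dots> \<le> (\<Sum>l<m. 1)" using le1 by (intro sum_mono) auto
  finally show ?thesis by simp
qed

section \<open>Sums of squares that need many squares\<close>

lemma ex_poly_pos:
  fixes p :: "real poly"
  assumes "lead_coeff p > 0"
  shows "\<exists>x0. \<forall>x\<ge>x0. poly p x > 0"
  using poly_pinfty_gt_lc[OF assms] assms by (meson less_le_trans)

lemma eval2_as_poly: "eval2 f x y = poly (map_poly (\<lambda>c. poly c x) f) y"
  by (induction f) (simp_all add: map_poly_pCons)

text \<open>
  First the columns are placed where the leading coefficient of \<open>f\<close> in \<open>y\<close> is positive; then, on
  the finitely many columns in question, \<open>f\<close> is positive for all large \<open>y\<close>. The columns with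
  \<open>a \<ge> N\<close> only complete an injective sequence.
\<close>

lemma ex_positive_grid:
  fixes f :: "real poly poly" and N :: nat
  assumes "lead_coeff (lead_coeff f) > 0"
  shows "\<exists>u v :: nat \<Rightarrow> real. inj u \<and> inj v \<and> (\<forall>a<N. \<forall>b. eval2 f (u a) (v b) > 0)"
proof -
  obtain x0 where x0: "\<And>x. x \<ge> x0 \<Longrightarrow> poly (lead_coeff f) x > 0"
    using ex_poly_pos[OF assms] by blast
  define u where "u a = x0 + real a" for a
  have "\<exists>y0. \<forall>y\<ge>y0. eval2 f (u a) y > 0" for a
  proof -
    define p where "p = map_poly (\<lambda>c. poly c (u a)) f"
    have coeff_p: "coeff p j = poly (coeff f j) (u a)" for j
      by (simp add: p_def coeff_map_poly)
    have pos: "coeff p (degree f) > 0" unfolding coeff_p by (rule x0) (simp add: u_def)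
    moreover have "degree p = degree f"
      using pos by (intro order.antisym degree_le le_degree) (auto simp: coeff_p coeff_eq_0)
    ultimately have "lead_coeff p > 0" by simp
    from ex_poly_pos[OF this] show ?thesis by (simp add: eval2_as_poly p_def)
  qed
  then obtain y0 where y0: "\<And>a y. y \<ge> y0 a \<Longrightarrow> eval2 f (u a) y > 0" by metis
  define v where "v b = (\<Sum>a<N. \<bar>y0 a\<bar>) + real b" for b
  have "eval2 f (u a) (v b) > 0" if "a < N" for a b
  proof (rule y0)
    have "\<bar>y0 a\<bar> \<le> (\<Sum>a<N. \<bar>y0 a\<bar>)" using that by (intro member_le_sum) auto
    then show "y0 a \<le> v b" by (simp add: v_def)
  qed
  moreover have "inj u" "inj v" by (auto simp: inj_def u_def v_def)
  ultimately show ?thesis by blast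
qed

lemma weight_lt_sum:
  assumes "\<And>i. i \<in> A \<Longrightarrow> weight_lt W D (p i)"
  shows "weight_lt W D (\<Sum>i\<in>A. p i)"
  unfolding weight_lt_def coeff_sum
proof (intro allI impI)
  fix i j assume "(\<Sum>k\<in>A. coeff (coeff (p k) j) i) \<noteq> 0"
  then obtain k where "k \<in> A" "coeff (coeff (p k) j) i \<noteq> 0"
    by (meson sum.not_neutral_contains_not_neutral)
  then show "i + W * j < D" using assms by (auto simp: weight_lt_def)
qed

lemma ex_long_sum_of_squares:
  fixes f :: "real poly poly"
  assumes pos: "lead_coeff (lead_coeff f) > 0"
    and nonconst: "degree f \<noteq> 0 \<or> degree (lead_coeff f) \<noteq> 0"
  shows "\<exists>q :: nat \<Rightarrow> real poly poly. \<forall>m s t.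
    (\<Sum>j\<le>n. q j ^ 2) = (\<Sum>l<m. s l ^ 2) + f * (\<Sum>l<m. t l ^ 2) \<longrightarrow> n < m"
proof -
  \<comment> \<open>A crude choice of a number that exceeds all \<open>x\<close>-degrees in \<open>f\<close>.\<close>
  define W where "W = Suc (\<Sum>j\<le>degree f. degree (coeff f j))"
  have W: "degree (coeff f j) < W" for j
  proof (cases "j \<le> degree f")
    case True
    then have "degree (coeff f j) \<le> (\<Sum>j\<le>degree f. degree (coeff f j))"
      by (intro member_le_sum) auto
    then show ?thesis by (simp add: W_def)
  qed (simp add: coeff_eq_0 W_def)
  then have "W > 0" by (simp add: W_def)
  obtain u v :: "nat \<Rightarrow> real" where inj: "inj u" "inj v"
    and grid: "\<And>a b. a < W * n \<Longrightarrow> eval2 f (u a) (v b) > 0"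
    using ex_positive_grid[OF pos, of "W * n"] by blast
  define q where "q = grid_basis W u v n"
  define h where "h = (\<Sum>j\<le>n. q j ^ 2)"
  have wh: "weight_lt W (Suc (2 * (W * n))) h"
    unfolding h_def
  proof (rule weight_lt_sum)
    fix j assume "j \<in> {..n}"
    then have "weight_lt W (Suc (W * n)) (q j)"
      unfolding q_def by (intro weight_lt_grid_basis) simp
    from weight_lt_mult[OF this this] show "weight_lt W (Suc (2 * (W * n))) (q j ^ 2)"
      by (simp add: power2_eq_square mult_2)
  qed
  have "n < m" if eq: "h = (\<Sum>l<m. s l ^ 2) + f * (\<Sum>l<m. t l ^ 2)" for m s t
  proof -
    have vanish: "eval2 (s l) (u a) (v b) = 0" "eval2 (t l) (u a) (v b) = 0"
      if "l < m" "b < n" "a < W * (n - b)" for l a b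
    proof -
      have zero: "eval2 (q j) (u a) (v b) = 0" if "j \<le> n" for j
      proof (cases "j \<le> b")
        case True
        then have "W * (n - b) \<le> W * (n - j)" by (intro mult_le_mono2) simp
        then have "a < W * (n - j)" using \<open>a < W * (n - b)\<close> by linarith
        then show ?thesis by (simp add: q_def eval2_grid_basis_eq_0_iff[OF inj])
      qed (simp add: q_def eval2_grid_basis_eq_0_iff[OF inj])
      have "W * (n - b) \<le> W * n" by (intro mult_le_mono2) simp
      then have fpos: "eval2 f (u a) (v b) > 0" using that by (intro grid) linarith
      have "0 = eval2 h (u a) (v b)" using zero by (simp add: h_def poly_sum)
      also have "\<dots> = (\<Sum>l<m. (eval2 (s l) (u a) (v b))\<^sup>2) +
          eval2 f (u a) (v b) * (\<Sum>l<m. (eval2 (t l) (u a) (v b))\<^sup>2)"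
        by (simp add: eq poly_sum)
      finally have sum0: "(\<Sum>l<m. (eval2 (s l) (u a) (v b))\<^sup>2) +
          eval2 f (u a) (v b) * (\<Sum>l<m. (eval2 (t l) (u a) (v b))\<^sup>2) = 0" ..
      have nonneg: "(\<Sum>l<m. (eval2 (r l) (u a) (v b))\<^sup>2) \<ge> 0" for r :: "nat \<Rightarrow> real poly poly"
        by (intro sum_nonneg) auto
      then have "eval2 f (u a) (v b) * (\<Sum>l<m. (eval2 (t l) (u a) (v b))\<^sup>2) \<ge> 0"
        using fpos by (intro mult_nonneg_nonneg) auto
      with sum0 nonneg[of s] fpos have "(\<Sum>l<m. (eval2 (s l) (u a) (v b))\<^sup>2) = 0"
        "(\<Sum>l<m. (eval2 (t l) (u a) (v b))\<^sup>2) = 0"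
        by (smt (verit) mult_eq_0_iff)+
      then show "eval2 (s l) (u a) (v b) = 0" "eval2 (t l) (u a) (v b) = 0"
        using \<open>l < m\<close> by (auto simp: sum_nonneg_eq_0_iff)
    qed
    have "t l = 0" if "l < m" for l
      using weight_lt_of_sum_of_squares(2)[OF pos nonconst W eq wh that] vanish(2)[OF that]
      by (rule vanish_staircase_weight_lt_imp_0[OF inj])
    then have h_eq: "h = (\<Sum>l<m. s l ^ 2)" using eq by simp
    have "\<exists>c. s l = (\<Sum>j\<le>n. [:[:c j:]:] * q j)" if "l < m" for l
      unfolding q_def
      using weight_lt_of_sum_of_squares(1)[OF pos nonconst W eq wh that] vanish(1)[OF that]
      by (rule vanish_staircase_in_span[OF inj \<open>W > 0\<close>])
    then obtain c where c: "\<And>l. l < m \<Longrightarrow> s l = (\<Sum>j\<le>n. [:[:c l j:]:] * q j)" by metis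
    \<comment> \<open>The difference of the two Gram matrices of \<open>h\<close>.\<close>
    define g where "g i j = (\<Sum>l<m. c l i * c l j) - (if i = j then 1 else 0)" for i j
    have zero: "(\<Sum>i\<le>n. \<Sum>j\<le>n. g i j * (eval2 (q i) x y * eval2 (q j) x y)) = 0" for x y
    proof -
      let ?e = "\<lambda>j. eval2 (q j) x y"
      have "(\<Sum>j\<le>n. (?e j)\<^sup>2) = (\<Sum>l<m. (eval2 (s l) x y)\<^sup>2)"
        using arg_cong[OF h_eq, of "\<lambda>p. eval2 p x y"] by (simp add: h_def poly_sum)
      also have "\<dots> = (\<Sum>l<m. (\<Sum>j\<le>n. c l j * ?e j)\<^sup>2)"
        by (simp add: c poly_sum)
      also have "\<dots> = (\<Sum>l<m. \<Sum>i\<le>n. \<Sum>j\<le>n. c l i * c l j * (?e i * ?e j))"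
        by (simp add: power2_eq_square sum_product algebra_simps)
      also have "\<dots> = (\<Sum>i\<le>n. \<Sum>j\<le>n. \<Sum>l<m. c l i * c l j * (?e i * ?e j))"
        by (subst sum.swap) (intro sum.cong refl sum.swap)
      also have "\<dots> = (\<Sum>i\<le>n. \<Sum>j\<le>n. g i j * (?e i * ?e j) + (if i = j then ?e i * ?e j else 0))"
        by (intro sum.cong refl) (simp add: g_def algebra_simps sum_distrib_left)
      also have "\<dots> = (\<Sum>i\<le>n. \<Sum>j\<le>n. g i j * (?e i * ?e j)) + (\<Sum>i\<le>n. (?e i)\<^sup>2)"
        by (simp add: sum.distrib power2_eq_square)
      finally show ?thesis by simp
    qed
    have g0: "g i j = 0" if "i \<le> j" "j \<le> n" for i j
    proof (rule grid_basis_gram_unique[OF inj \<open>W > 0\<close> _ _ that])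
      show "g r s = g s r" for r s by (simp add: g_def mult.commute eq_commute)
    qed (use zero in \<open>simp add: q_def\<close>)
    have "(\<Sum>l<m. c l i * c l j) = (if i = j then 1 else 0)" if "i < Suc n" "j < Suc n" for i j
      using g0[of i j] g0[of j i] that by (cases "i \<le> j") (auto simp: g_def mult.commute)
    from orthonormal_card_le[of "Suc n", OF this] show "n < m" by simp
  qed
  then show ?thesis unfolding h_def by blast
qed

section \<open>Linear changes of variables\<close>

lemma poly_poly_eqI:
  fixes p q :: "real poly poly"
  assumes "\<And>x y. eval2 p x y = eval2 q x y"
  shows "p = q"
proof (rule poly_eqI)
  fix j
  have "map_poly (\<lambda>c. poly c x) p = map_poly (\<lambda>c. poly c x) q" for x
    using assms[of _ x] by (subst poly_eq_poly_eq_iff[symmetric]) (simp add: eval2_as_poly fun_eq_iff)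
  then have "poly (coeff p j) x = poly (coeff q j) x" for x
    by (metis coeff_map_poly poly_0)
  then show "coeff p j = coeff q j" by (simp add: poly_eq_poly_eq_iff[symmetric] fun_eq_iff)
qed

lemma linear_change_add: "linear_change (p + q) M = linear_change p M + linear_change q M"
  and linear_change_mult: "linear_change (p * q) M = linear_change p M * linear_change q M"
  by (rule poly_poly_eqI; simp add: poly_linear_change)+

lemma linear_change_sum_squares:
  "linear_change (\<Sum>i\<in>A. p i ^ 2) M = (\<Sum>i\<in>A. linear_change (p i) M ^ 2)"
  by (rule poly_poly_eqI) (simp add: poly_linear_change poly_sum)

lemma linear_change_mat_1: "linear_change f (mat 1) = f"
  by (rule poly_poly_eqI) (simp add: poly_linear_change mat_def)

lemma linear_change_linear_change:
  "linear_change (linear_change f M) N = linear_change f (M ** N)"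
  by (rule poly_poly_eqI)
    (simp add: poly_linear_change matrix_matrix_mult_def sum_2 algebra_simps)

text \<open>
  Used for the reflections of the coordinate axes, which can only change the signs of coefficients.
\<close>

lemma coeff_linear_change_diagonal:
  assumes "M $ 1 $ 2 = 0" "M $ 2 $ 1 = 0"
  shows "coeff (coeff (linear_change f M) j) i =
    (M $ 1 $ 1) ^ i * (M $ 2 $ 2) ^ j * coeff (coeff f j) i"
proof -
  define g where "g = map_poly (\<lambda>c. pcompose c [:0, M $ 1 $ 1:]) f"
  have g: "eval2 g x y = eval2 f (M $ 1 $ 1 * x) y" for x y
    unfolding g_def by (induction f) (simp_all add: map_poly_pCons poly_pcompose mult.commute)
  have "linear_change f M = pcompose g [:0, [:M $ 2 $ 2:]:]"
    by (rule poly_poly_eqI) (simp add: poly_linear_change assms poly_pcompose g mult.commute)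
  then show ?thesis
    by (simp add: coeff_pcompose_linear g_def coeff_map_poly poly_const_pow)
qed

lemma admissible_imp_positive:
  assumes "admissible f"
  shows "\<exists>M. invertible M \<and> lead_coeff (lead_coeff (linear_change f M)) > 0 \<and>
    (degree (linear_change f M) \<noteq> 0 \<or> degree (lead_coeff (linear_change f M)) \<noteq> 0)"
proof -
  obtain M where M: "invertible M" "strictly_admissible (linear_change f M)"
    using assms by (auto simp: admissible_def)
  define F where "F = linear_change f M"
  define d b \<alpha> where "d = degree F" and "b = degree (lead_coeff F)" and "\<alpha> = lead_coeff (lead_coeff F)"
  have nonconst: "F \<noteq> [:[:c:]:]" for c
    using M(2) by (auto simp: strictly_admissible_def F_def)
  then have "F \<noteq> 0" by (metis pCons_0_0)
  then have "\<alpha> \<noteq> 0" by (simp add: \<alpha>_def)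
  have db: "d \<noteq> 0 \<or> b \<noteq> 0"
  proof (rule ccontr)
    assume "\<not> (d \<noteq> 0 \<or> b \<noteq> 0)"
    then have "d = 0" "b = 0" by auto
    then obtain p where "F = [:p:]" unfolding d_def by (metis degree_eq_zeroE)
    moreover from this \<open>b = 0\<close> obtain c where "p = [:c:]"
      unfolding b_def by (auto elim: degree_eq_zeroE)
    ultimately show False using nonconst by simp
  qed
  have "\<exists>\<sigma> \<tau> :: real. \<sigma> \<noteq> 0 \<and> \<tau> \<noteq> 0 \<and> \<sigma> ^ b * \<tau> ^ d * \<alpha> > 0"
  proof (cases "\<alpha> > 0")
    case True
    then show ?thesis by (intro exI[of _ 1]) simp
  next
    case False
    with \<open>\<alpha> \<noteq> 0\<close> have "\<alpha> < 0" by simp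
    moreover have "odd b \<or> odd d"
      using M(2) False
      by (auto simp: strictly_admissible_def F_def[symmetric] d_def b_def \<alpha>_def Let_def)
    ultimately show ?thesis
    proof (elim disjE)
      assume "odd b"
      then show ?thesis using \<open>\<alpha> < 0\<close> by (intro exI[of _ "-1"] exI[of _ 1]) simp
    next
      assume "odd d"
      then show ?thesis using \<open>\<alpha> < 0\<close> by (intro exI[of _ 1] exI[of _ "-1"]) simp
    qed
  qed
  then obtain \<sigma> \<tau> :: real where \<sigma>\<tau>: "\<sigma> \<noteq> 0" "\<tau> \<noteq> 0" "\<sigma> ^ b * \<tau> ^ d * \<alpha> > 0" by blast
  define N :: "real^2^2" where "N = vector [vector [\<sigma>, 0], vector [0, \<tau>]]"
  have "det N \<noteq> 0" using \<sigma>\<tau> by (simp add: N_def det_2)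
  then have "invertible N" by (simp add: invertible_det_nz)
  define G where "G = linear_change f (M ** N)"
  have cG: "coeff (coeff G j) i = \<sigma> ^ i * \<tau> ^ j * coeff (coeff F j) i" for i j
    unfolding G_def linear_change_linear_change[symmetric] F_def[symmetric]
    by (subst coeff_linear_change_diagonal) (simp_all add: N_def)
  have zero: "coeff G j = 0 \<longleftrightarrow> coeff F j = 0" for j
    using \<sigma>\<tau> by (simp add: poly_eq_iff cG)
  have "degree G = d"
    unfolding d_def using \<open>F \<noteq> 0\<close>
    by (intro order.antisym degree_le le_degree) (auto simp: zero coeff_eq_0)
  moreover have "degree (coeff G d) = b"
    unfolding b_def d_def using \<open>F \<noteq> 0\<close> \<sigma>\<tau>
    by (intro order.antisym degree_le le_degree) (auto simp: cG coeff_eq_0)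
  ultimately have "lead_coeff (lead_coeff G) > 0" "degree G \<noteq> 0 \<or> degree (lead_coeff G) \<noteq> 0"
    using \<sigma>\<tau>(3) db by (simp_all add: cG b_def d_def \<alpha>_def)
  then show ?thesis
    using invertible_mult[OF M(1) \<open>invertible N\<close>] unfolding G_def by blast
qed

section \<open>The ring with the square root\<close>

lemma finsum_class: "finsum cring_class_ops p A = sum p A"
  by (induction A rule: infinite_finite_induct)
    (simp_all add: cring_class.finsum_infinite carrier_class)

lemma coset_class:
  "PIdl\<^bsub>cring_class_ops\<^esub> g +>\<^bsub>cring_class_ops\<^esub> p = range (\<lambda>q. q * g + p)"
  by (auto simp: cgenideal_def a_r_coset_def r_coset_def cring_class_ops_def)

lemma coset_class_eq_iff:
  "PIdl\<^bsub>cring_class_ops\<^esub> g +>\<^bsub>cring_class_ops\<^esub> p =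
   PIdl\<^bsub>cring_class_ops\<^esub> g +>\<^bsub>cring_class_ops\<^esub> q \<longleftrightarrow> g dvd p - q" for g p q :: "'a::comm_ring_1"
proof
  assume "PIdl\<^bsub>cring_class_ops\<^esub> g +>\<^bsub>cring_class_ops\<^esub> p =
    PIdl\<^bsub>cring_class_ops\<^esub> g +>\<^bsub>cring_class_ops\<^esub> q"
  then have "0 * g + p \<in> range (\<lambda>r. r * g + q)" unfolding coset_class by blast
  then show "g dvd p - q" by auto
next
  assume "g dvd p - q"
  then obtain r where r: "p = r * g + q" by (metis dvd_def diff_eq_eq mult.commute)
  show "PIdl\<^bsub>cring_class_ops\<^esub> g +>\<^bsub>cring_class_ops\<^esub> p =
    PIdl\<^bsub>cring_class_ops\<^esub> g +>\<^bsub>cring_class_ops\<^esub> q"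
    unfolding coset_class
  proof (intro equalityI subsetI)
    fix z assume "z \<in> range (\<lambda>s. s * g + p)"
    then obtain s where "z = (s + r) * g + q" by (auto simp: r algebra_simps)
    then show "z \<in> range (\<lambda>r. r * g + q)" by blast
  next
    fix z assume "z \<in> range (\<lambda>s. s * g + q)"
    then obtain s where "z = (s - r) * g + p" by (auto simp: r algebra_simps)
    then show "z \<in> range (\<lambda>r. r * g + p)" by blast
  qed
qed

lemma is_sum_of_squares_quotient_iff:
  fixes g p :: "'a::comm_ring_1"
  shows "is_sum_of_squares (cring_class_ops Quot (PIdl\<^bsub>cring_class_ops\<^esub> g)) n
      (PIdl\<^bsub>cring_class_ops\<^esub> g +>\<^bsub>cring_class_ops\<^esub> p) \<longleftrightarrow>
    (\<exists>s. g dvd p - (\<Sum>i<n. s i ^ 2))"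
proof -
  let ?P = "cring_class_ops :: 'a ring"
  let ?I = "PIdl\<^bsub>?P\<^esub> g"
  let ?c = "\<lambda>p. ?I +>\<^bsub>?P\<^esub> p"
  have "ideal ?I ?P" by (intro cring.cgenideal_ideal[OF cring_class] carrier_class)
  then interpret h: ring_hom_cring ?P "?P Quot ?I" ?c
    by (rule ideal.rcos_ring_hom_cring[OF _ cring_class])
  have sum: "(\<Oplus>\<^bsub>?P Quot ?I\<^esub>i\<in>{..<n}. ?c (s i) \<otimes>\<^bsub>?P Quot ?I\<^esub> ?c (s i)) = ?c (\<Sum>i<n. s i ^ 2)" for s
  proof -
    have "?c (\<Sum>i<n. s i ^ 2) = ?c (finsum ?P (\<lambda>i. s i \<otimes>\<^bsub>?P\<^esub> s i) {..<n})"
      by (simp add: finsum_class times_class power2_eq_square)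
    also have "\<dots> = (\<Oplus>\<^bsub>?P Quot ?I\<^esub>i\<in>{..<n}. (?c \<circ> (\<lambda>i. s i \<otimes>\<^bsub>?P\<^esub> s i)) i)"
      by (rule h.hom_finsum) (simp add: carrier_class)
    also have "\<dots> = (\<Oplus>\<^bsub>?P Quot ?I\<^esub>i\<in>{..<n}. ?c (s i) \<otimes>\<^bsub>?P Quot ?I\<^esub> ?c (s i))"
      by (simp only: o_def h.hom_mult[OF carrier_class carrier_class])
    finally show ?thesis ..
  qed
  have carrier: "carrier (?P Quot ?I) = range ?c"
    unfolding FactRing_def A_RCOSETS_def' partial_object.simps using carrier_class by blast
  have "is_sum_of_squares (?P Quot ?I) n (?c p) \<longleftrightarrow> (\<exists>s. ?c p = ?c (\<Sum>i<n. s i ^ 2))"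
  proof
    assume "is_sum_of_squares (?P Quot ?I) n (?c p)"
    then obtain S where S: "S \<in> {..<n} \<rightarrow> range ?c"
      "?c p = (\<Oplus>\<^bsub>?P Quot ?I\<^esub>i\<in>{..<n}. S i \<otimes>\<^bsub>?P Quot ?I\<^esub> S i)"
      unfolding is_sum_of_squares_def carrier by blast
    from S(1) have "\<forall>i\<in>{..<n}. \<exists>x. S i = ?c x" by blast
    then obtain s where s: "\<And>i. i \<in> {..<n} \<Longrightarrow> S i = ?c (s i)" by metis
    have "?c p = (\<Oplus>\<^bsub>?P Quot ?I\<^esub>i\<in>{..<n}. ?c (s i) \<otimes>\<^bsub>?P Quot ?I\<^esub> ?c (s i))"
      unfolding S(2)
      by (rule h.S.finsum_cong') (use h.S.m_closed h.hom_closed carrier_class s in \<open>auto\<close>)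
    then show "\<exists>s. ?c p = ?c (\<Sum>i<n. s i ^ 2)" unfolding sum by blast
  next
    assume "\<exists>s. ?c p = ?c (\<Sum>i<n. s i ^ 2)"
    then obtain s where "?c p = ?c (\<Sum>i<n. s i ^ 2)" ..
    then show "is_sum_of_squares (?P Quot ?I) n (?c p)"
      unfolding is_sum_of_squares_def sum[symmetric] carrier by (intro exI[of _ "\<lambda>i. ?c (s i)"]) simp
  qed
  then show ?thesis by (simp only: coset_class_eq_iff)
qed

text \<open>
  Division with remainder by the monic polynomial \<open>z\<^sup>2 - f\<close>; the coefficients need not lie in a
  field, so it is done by hand with the rule \<open>z (a + b z) = f b + a z + b (z\<^sup>2 - f)\<close>.
\<close>

lemma linear_remainder:
  fixes f :: "'a::comm_ring_1"
  shows "\<exists>a b. [:- f, 0, 1:] dvd p - [:a, b:]"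
proof (induction p)
  case 0
  show ?case by (intro exI[of _ 0]) simp
next
  case (pCons c p)
  then obtain a b where "[:- f, 0, 1:] dvd p - [:a, b:]" by blast
  then have "[:- f, 0, 1:] dvd [:0, 1:] * (p - [:a, b:]) + [:b:] * [:- f, 0, 1:]"
    by (intro dvd_add dvd_mult dvd_refl)
  also have "[:0, 1:] * (p - [:a, b:]) + [:b:] * [:- f, 0, 1:] = pCons c p - [:c + f * b, a:]"
    by (simp add: algebra_simps)
  finally show ?case by blast
qed

text \<open>
  Only the part of \<open>\<Sum>\<^sub>l (s\<^sub>l + t\<^sub>l z)\<^sup>2\<close> that is free of \<open>z\<close> is compared. The comparison is allowed since
  1 and \<open>z\<close> are linearly independent modulo \<open>z\<^sup>2 - f\<close>, for degree reasons.
\<close>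

lemma sum_of_squares_adjoin_sqrtD:
  fixes f h :: "'a::idom" and m :: nat
  assumes "[:- f, 0, 1:] dvd [:h:] - (\<Sum>l<m. S l ^ 2)"
  shows "\<exists>s t. h = (\<Sum>l<m. s l ^ 2) + f * (\<Sum>l<m. t l ^ 2)"
proof -
  let ?g = "[:- f, 0, 1:]"
  have "\<exists>a b. ?g dvd S l - [:a, b:]" for l by (rule linear_remainder)
  then obtain s t where st: "\<And>l. ?g dvd S l - [:s l, t l:]" by metis
  have rearrange: "(A - B) * (A + B) + C = A ^ 2 - (B ^ 2 - C)" for A B C :: "'a poly"
    by (simp add: power2_eq_square algebra_simps)
  have square: "?g dvd S l ^ 2 - [:s l ^ 2 + f * t l ^ 2, 2 * s l * t l:]" for l
  proof -
    have "?g dvd (S l - [:s l, t l:]) * (S l + [:s l, t l:]) + [:t l ^ 2:] * ?g"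
      using st by (intro dvd_add dvd_mult2 dvd_mult dvd_refl)
    also have "(S l - [:s l, t l:]) * (S l + [:s l, t l:]) + [:t l ^ 2:] * ?g =
      S l ^ 2 - ([:s l, t l:] ^ 2 - [:t l ^ 2:] * ?g)"
      by (rule rearrange)
    also have "[:s l, t l:] ^ 2 - [:t l ^ 2:] * ?g = [:s l ^ 2 + f * t l ^ 2, 2 * s l * t l:]"
      by (simp add: power2_eq_square)
    finally show ?thesis .
  qed
  define u where "u = (\<Sum>l<m. s l ^ 2) + f * (\<Sum>l<m. t l ^ 2)"
  define v where "v = (\<Sum>l<m. 2 * s l * t l)"
  have "(\<Sum>l<m. [:s l ^ 2 + f * t l ^ 2, 2 * s l * t l:]) = [:u, v:]"
    unfolding u_def v_def by (induction m) (simp_all add: algebra_simps)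
  moreover have "?g dvd (\<Sum>l<m. S l ^ 2 - [:s l ^ 2 + f * t l ^ 2, 2 * s l * t l:])"
    using square by (intro dvd_sum)
  ultimately have "?g dvd (\<Sum>l<m. S l ^ 2) - [:u, v:]" by (simp add: sum_subtractf)
  from dvd_add[OF assms this] have "?g dvd [:h - u, - v:]" by simp
  moreover have "\<not> ?g dvd [:h - u, - v:]" if "[:h - u, - v:] \<noteq> 0"
    using dvd_imp_degree_le[OF _ that, of ?g] degree_pCons_le[of "h - u" "[:- v:]"] by auto
  ultimately have "[:h - u, - v:] = 0" by blast
  then have "h = u" by simp
  then show ?thesis unfolding u_def by blast
qed

lemma not_pythagoras_bound_adjoin_sqrt:
  assumes "\<exists>q. \<forall>m s t.
    (\<Sum>j\<le>n. q j ^ 2) = (\<Sum>l<m. s l ^ 2) + f * (\<Sum>l<m. t l ^ 2) \<longrightarrow> n < m"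
  shows "\<not> pythagoras_bound (adjoin_sqrt f) n"
proof
  let ?g = "[:- f, 0, 1:]"
  let ?c = "\<lambda>p. PIdl\<^bsub>cring_class_ops\<^esub> ?g +>\<^bsub>cring_class_ops\<^esub> p"
  assume bound: "pythagoras_bound (adjoin_sqrt f) n"
  obtain q where q: "\<And>m s t.
    (\<Sum>j\<le>n. q j ^ 2) = (\<Sum>l<m. s l ^ 2) + f * (\<Sum>l<m. t l ^ 2) \<Longrightarrow> n < m"
    using assms by blast
  define h where "h = (\<Sum>j\<le>n. q j ^ 2)"
  have "[:h:] = (\<Sum>j<Suc n. [:q j:] ^ 2)"
    unfolding h_def lessThan_Suc_atMost by (simp only: poly_const_pow sum_to_poly)
  then have "is_sum_of_squares (adjoin_sqrt f) (Suc n) (?c [:h:])"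
    unfolding adjoin_sqrt_def Let_def is_sum_of_squares_quotient_iff
    by (intro exI[of _ "\<lambda>j. [:q j:]"]) simp
  with bound obtain m where "m \<le> n" "is_sum_of_squares (adjoin_sqrt f) m (?c [:h:])"
    unfolding pythagoras_bound_def by blast
  then obtain S where "?g dvd [:h:] - (\<Sum>l<m. S l ^ 2)"
    unfolding adjoin_sqrt_def Let_def is_sum_of_squares_quotient_iff by blast
  from sum_of_squares_adjoin_sqrtD[OF this] obtain s t
    where "h = (\<Sum>l<m. s l ^ 2) + f * (\<Sum>l<m. t l ^ 2)" by blast
  then have "n < m" unfolding h_def by (rule q)
  with \<open>m \<le> n\<close> show False by simp
qed

theorem theorem2p1:
  fixes f :: "real poly poly"
  assumes "admissible f"
    and "\<nexists>g. f = g ^ 2"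
  shows "pythagoras_number (adjoin_sqrt f) = \<infinity>"
proof -
  obtain M where M: "invertible M" "lead_coeff (lead_coeff (linear_change f M)) > 0"
    "degree (linear_change f M) \<noteq> 0 \<or> degree (lead_coeff (linear_change f M)) \<noteq> 0"
    using admissible_imp_positive[OF assms(1)] by blast
  obtain N where NM: "N ** M = mat 1"
    using M(1) by (auto simp: invertible_def)
  have "\<not> pythagoras_bound (adjoin_sqrt f) n" for n
  proof (rule not_pythagoras_bound_adjoin_sqrt)
    obtain q where q: "\<And>m s t. (\<Sum>j\<le>n. q j ^ 2) =
        (\<Sum>l<m. s l ^ 2) + linear_change f M * (\<Sum>l<m. t l ^ 2) \<Longrightarrow> n < m"
      using ex_long_sum_of_squares[OF M(2,3), of n] by blast
    \<comment> \<open>Applying \<open>M\<close> to an identity for \<open>f\<close> gives one for \<open>linear_change f M\<close>.\<close>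
    have "n < m" if "(\<Sum>j\<le>n. linear_change (q j) N ^ 2) =
        (\<Sum>l<m. s l ^ 2) + f * (\<Sum>l<m. t l ^ 2)" for m s t
    proof (rule q)
      have "(\<Sum>j\<le>n. q j ^ 2) = linear_change (\<Sum>j\<le>n. linear_change (q j) N ^ 2) M"
        by (simp add: linear_change_sum_squares linear_change_linear_change NM linear_change_mat_1)
      also have "\<dots> = (\<Sum>l<m. linear_change (s l) M ^ 2) +
          linear_change f M * (\<Sum>l<m. linear_change (t l) M ^ 2)"
        by (simp add: that linear_change_add linear_change_mult linear_change_sum_squares)
      finally show "(\<Sum>j\<le>n. q j ^ 2) = (\<Sum>l<m. linear_change (s l) M ^ 2) +
          linear_change f M * (\<Sum>l<m. linear_change (t l) M ^ 2)" .
    qed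
    then show "\<exists>q. \<forall>m s t.
        (\<Sum>j\<le>n. q j ^ 2) = (\<Sum>l<m. s l ^ 2) + f * (\<Sum>l<m. t l ^ 2) \<longrightarrow> n < m"
      by (intro exI[of _ "\<lambda>j. linear_change (q j) N"]) blast
  qed
  then show ?thesis by (simp add: pythagoras_number_def)
qed

end
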